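(* Let $\mathbb{F}$ be an algebraically closed field of characteristic zero and let $A$ be a non-Lie Leibniz algebra over $\mathbb{F}$ with $\dim(A)=2$. Then $A$ is isomorphic to a cyclic Leibniz algebra generated by an element $a$ (with basis $\{a,a^2\}$, where $a^2=[a,a]$) with either $[a,a^2]=0$ (hence $A$ is nilpotent) or $[a,a^2]=a^2$ (hence $A$ is solvable).
   Context: A (left) Leibniz algebra over $\mathbb{F}$ is an $\mathbb{F}$-vector space $A$ with a bilinear map $[\,,\,]:A\times A\to A$ satisfying $[x,[y,z]]=[[x,y],z]+[y,[x,z]]$ for all $x,y,z\in A$. It is a Lie algebra if and only if $[x,x]=0$ for all $x\in A$; otherwise it is called non-Lie. For $a\in A$ one puts $a^1=a$, $a^{k+1}=[a,a^k]$. An $n$-dimensional Leibniz algebra generated by a single element $a$ is called cyclic; it equals $\mathrm{span}\{a,a^2,\dots,a^n\}$, and $[a^k,x]=0$ for all $k\geq 2$ and all $x$. $A$ is nilpotent if for some $c$ every product of $c+1$ elements (with any bracketing) is $0$; $A$ is solvable if $A^{(m)}=0$ for some $m\ge0$, where $A^{(0)}=A$ and $A^{(i+1)}=[A^{(i)},A^{(i)}]$ (span of products). *)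

theory Defs
  imports "HOL-Analysis.Analysis"
begin

text \<open>
  Left Leibniz algebras. As for vector spaces in the library, the underlying set is a whole type.
\<close>

locale leibniz_algebra = vector_space scale
  for scale :: "'f::field \<Rightarrow> 'v::ab_group_add \<Rightarrow> 'v" +
  fixes bracket :: "'v \<Rightarrow> 'v \<Rightarrow> 'v"
  assumes linear_bracket_left: "Vector_Spaces.linear scale scale (\<lambda>x. bracket x y)"
    and linear_bracket_right: "Vector_Spaces.linear scale scale (\<lambda>y. bracket x y)"
    and leibniz: "bracket x (bracket y z) = bracket (bracket x y) z + bracket y (bracket x z)"
begin

definition is_lie :: bool
  where "is_lie \<longleftrightarrow> (\<forall>x. bracket x x = 0)"

definition subalgebra :: "'v set \<Rightarrow> bool"
  where "subalgebra S \<longleftrightarrow> subspace S \<and> (\<forall>x\<in>S. \<forall>y\<in>S. bracket x y \<in> S)"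

definition generated_by :: "'v \<Rightarrow> bool"
  where "generated_by a \<longleftrightarrow> subalgebra hull {a} = UNIV"

definition is_basis :: "'v set \<Rightarrow> bool"
  where "is_basis B \<longleftrightarrow> independent B \<and> span B = UNIV"

text \<open>\<open>is_product n x\<close>: \<open>x\<close> is a product of \<open>n\<close> elements, bracketed in some way.\<close>

inductive is_product :: "nat \<Rightarrow> 'v \<Rightarrow> bool"
  where
    single: "is_product 1 x"
  | bracket: "is_product m x \<Longrightarrow> is_product n y \<Longrightarrow> is_product (m + n) (bracket x y)"

definition nilpotent :: bool
  where "nilpotent \<longleftrightarrow> (\<exists>c. \<forall>x. is_product (c + 1) x \<longrightarrow> x = 0)"

primrec derived_series :: "nat \<Rightarrow> 'v set"
  where
    "derived_series 0 = UNIV"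
  | "derived_series (Suc i) =
       span {bracket x y | x y. x \<in> derived_series i \<and> y \<in> derived_series i}"

definition solvable :: bool
  where "solvable \<longleftrightarrow> (\<exists>m. derived_series m = {0})"

end

definition leibniz_isomorphic ::
  "('f::field \<Rightarrow> 'v::ab_group_add \<Rightarrow> 'v) \<Rightarrow> ('v \<Rightarrow> 'v \<Rightarrow> 'v) \<Rightarrow>
   ('f \<Rightarrow> 'w::ab_group_add \<Rightarrow> 'w) \<Rightarrow> ('w \<Rightarrow> 'w \<Rightarrow> 'w) \<Rightarrow> bool"
  where "leibniz_isomorphic scale1 bracket1 scale2 bracket2 \<longleftrightarrow>
    (\<exists>\<phi>. Vector_Spaces.linear scale1 scale2 \<phi> \<and> bij \<phi> \<and>
         (\<forall>x y. \<phi> (bracket1 x y) = bracket2 (\<phi> x) (\<phi> y)))"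

text \<open>
  Types cannot be existentially quantified, so an assertion that some two-dimensional Leibniz
  algebra exists has to fix an underlying vector space. Every two-dimensional algebra can be
  transported along a choice of basis to \<open>'f ^ 2\<close> with the componentwise scaling \<open>(*s)\<close>, so
  ranging over all brackets on that space loses no algebra up to isomorphism.
\<close>

end

theory Submission
  imports Defs
begin

text \<open>
  Pick \<open>x\<close> with \<open>b = [x, x] \<noteq> 0\<close>. The Leibniz identity kills every product \<open>[b, y]\<close>, so \<open>x\<close> and \<open>b\<close>
  are linearly independent, hence a basis. Applying the identity to \<open>x, b, x\<close> shows that \<open>[x, b]\<close>
  has no \<open>x\<close>-component, that is \<open>[x, b] = \<beta> b\<close>. If \<open>\<beta> = 0\<close> take \<open>a = x\<close>; otherwise take
  \<open>a = x / \<beta>\<close>, which normalises the eigenvalue to \<open>1\<close>.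
\<close>

section \<open>Model algebras on \<open>'f ^ 2\<close>\<close>

text \<open>With a = \<open>axis 1 1\<close> and b = \<open>axis 2 1\<close> this is the table
  [a, a] = b, [a, b] = \<gamma> b, [b, _] = 0, so both normal forms (\<gamma> = 0 and \<gamma> = 1)
  are treated at once.\<close>

definition cyclic2_bracket :: "'f::field \<Rightarrow> 'f ^ 2 \<Rightarrow> 'f ^ 2 \<Rightarrow> 'f ^ 2"
  where "cyclic2_bracket \<gamma> u v = (u $ 1 * (v $ 1 + \<gamma> * v $ 2)) *s axis 2 1"

lemma cyclic2_bracket_nth [simp]:
  "cyclic2_bracket \<gamma> u v $ 1 = 0"
  "cyclic2_bracket \<gamma> u v $ 2 = u $ 1 * (v $ 1 + \<gamma> * v $ 2)"
  by (simp_all add: cyclic2_bracket_def axis_def)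

text \<open>Products have first coordinate 0, so [[x, y], z] = 0. The Leibniz identity thus reduces
  to the symmetry of [x, [y, z]] in x and y.\<close>

lemma leibniz_algebra_cyclic2: "leibniz_algebra (*s) (cyclic2_bracket \<gamma>)"
proof (unfold_locales)
  fix x y z :: "'a ^ 2" and c :: 'a
  show "cyclic2_bracket \<gamma> (x + y) z = cyclic2_bracket \<gamma> x z + cyclic2_bracket \<gamma> y z"
    "cyclic2_bracket \<gamma> (c *s x) z = c *s cyclic2_bracket \<gamma> x z"
    "cyclic2_bracket \<gamma> x (y + z) = cyclic2_bracket \<gamma> x y + cyclic2_bracket \<gamma> x z"
    "cyclic2_bracket \<gamma> x (c *s z) = c *s cyclic2_bracket \<gamma> x z"
    "cyclic2_bracket \<gamma> x (cyclic2_bracket \<gamma> y z) =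
      cyclic2_bracket \<gamma> (cyclic2_bracket \<gamma> x y) z + cyclic2_bracket \<gamma> y (cyclic2_bracket \<gamma> x z)"
    by (simp_all add: vec_eq_iff forall_2 algebra_simps)
qed

lemma cyclic2_bracket_axis [simp]:
  "cyclic2_bracket \<gamma> (axis 1 1) (axis 1 1) = axis 2 1"
  "cyclic2_bracket \<gamma> (axis 1 1) (axis 2 1) = \<gamma> *s axis 2 1"
  by (simp_all add: vec_eq_iff forall_2 axis_def)

lemma axis_1_neq_axis_2: "axis 1 1 \<noteq> (axis 2 1 :: 'f::field ^ 2)"
  by (simp add: axis_eq_axis)

lemma vec2_eq_axis_sum:
  fixes u :: "'f::field ^ 2"
  shows "u = (u $ 1) *s axis 1 1 + (u $ 2) *s axis 2 1"
  by (simp add: vec_eq_iff forall_2 axis_def)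

lemma is_basis_axis2:
  "leibniz_algebra.is_basis (*s) {axis 1 1, axis 2 1 :: 'f::field ^ 2}"
proof -
  have "{axis 1 1, axis 2 1} = (cart_basis :: ('f ^ 2) set)"
    by (auto simp: cart_basis_def) (metis exhaust_2)
  then show ?thesis
    unfolding leibniz_algebra.is_basis_def [OF leibniz_algebra_cyclic2]
    using independent_cart_basis span_cart_basis by metis
qed

text \<open>A subalgebra containing \<open>axis 1 1\<close> contains its square
  \<open>axis 2 1\<close>, and these two vectors span.\<close>

lemma generated_by_cyclic2:
  "leibniz_algebra.generated_by (*s) (cyclic2_bracket \<gamma>) (axis 1 1)"
proof -
  interpret C: leibniz_algebra "(*s)" "cyclic2_bracket \<gamma>"
    by (rule leibniz_algebra_cyclic2)
  have "u \<in> S" if S: "C.subalgebra S" "axis 1 1 \<in> S" for S and u :: "'a ^ 2"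
  proof -
    have "cyclic2_bracket \<gamma> (axis 1 1) (axis 1 1) \<in> S"
      using S unfolding C.subalgebra_def by blast
    then have "(u $ 1) *s axis 1 1 + (u $ 2) *s axis 2 1 \<in> S"
      using S unfolding C.subalgebra_def
      by (simp add: vec.subspace_add vec.subspace_scale)
    then show ?thesis
      using vec2_eq_axis_sum [of u] by simp
  qed
  then show ?thesis
    unfolding C.generated_by_def hull_def by blast
qed

section \<open>Structure of a two-dimensional algebra with a nonzero square\<close>

context leibniz_algebra
begin

sublocale left: Vector_Spaces.linear scale scale "\<lambda>x. bracket x y" for y
  by (rule linear_bracket_left)

sublocale right: Vector_Spaces.linear scale scale "\<lambda>y. bracket x y" for x
  by (rule linear_bracket_right)

text \<open>In the Leibniz identity for x, x, y the last term equals the left-hand side and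
  cancels.\<close>

lemma bracket_square_left: "bracket (bracket x x) y = 0"
  using leibniz [of x x y] by simp

text \<open>If x = k [x, x], bracketing with x on the right gives [x, x] = k [[x, x], x] =
  0.\<close>

lemma square_notin_span:
  assumes "bracket x x \<noteq> 0"
  shows "x \<notin> span {bracket x x}"
proof
  assume "x \<in> span {bracket x x}"
  then obtain k where "x = scale k (bracket x x)"
    by (auto simp: span_singleton)
  then have "bracket x x = scale k (bracket (bracket x x) x)"
    by (metis left.scale)
  then show False
    using assms by (simp add: bracket_square_left)
qed

lemma independent_square:
  assumes "bracket x x \<noteq> 0"
  shows "independent {x, bracket x x}"
  using assms square_notin_span [OF assms] by (auto simp: independent_insert span_zero)

lemma span_pair_eq_UNIV:
  assumes "dim (UNIV :: 'v set) = 2" "independent {x, y}" "x \<noteq> y"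
  shows "span {x, y} = UNIV"
proof (rule ccontr)
  assume "span {x, y} \<noteq> UNIV"
  then obtain v where v: "v \<notin> span {x, y}"
    by blast
  then have ind: "independent {v, x, y}" and ne: "v \<noteq> x" "v \<noteq> y"
    using assms by (auto simp: independent_insert span_base)
  \<comment> \<open>Having cardinality 2, \<open>B\<close> is finite, so it bounds the size of every
    independent set.\<close>
  obtain B where B: "UNIV \<subseteq> span B" "card B = 2"
    using basis_exists [of UNIV] assms(1) by metis
  have "card {v, x, y} \<le> card B"
    using B ind by (intro conjunct2 [OF independent_span_bound]) (auto intro: card_ge_0_finite)
  then show False
    using ne assms(3) B by simp
qed

lemma span_square_eq_UNIV:
  assumes "dim (UNIV :: 'v set) = 2" "bracket x x \<noteq> 0"
  shows "span {x, bracket x x} = UNIV"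
proof (rule span_pair_eq_UNIV [OF assms(1) independent_square [OF assms(2)]])
  show "x \<noteq> bracket x x"
    using square_notin_span [OF assms(2)] span_base by force
qed

lemma span_squareE:
  assumes "dim (UNIV :: 'v set) = 2" "bracket x x \<noteq> 0"
  obtains r s where "y = scale r x + scale s (bracket x x)"
proof -
  have "y \<in> span {x, bracket x x}"
    using span_square_eq_UNIV [OF assms] by simp
  then obtain r s where "y - scale r x = scale s (bracket x x)"
    by (auto simp: span_insert span_singleton)
  then show ?thesis
    using that by (metis add.commute diff_add_cancel)
qed

lemma bracket_square_right_eigen:
  assumes "dim (UNIV :: 'v set) = 2" "bracket x x \<noteq> 0"
  obtains \<beta> where "bracket x (bracket x x) = scale \<beta> (bracket x x)"
proof -
  obtain r s where rs: "bracket x (bracket x x) = scale r x + scale s (bracket x x)"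
    using span_squareE [OF assms] .
  \<comment> \<open>With b = [x, x], the terms [x, [b, x]] and [b, [x, x]] of the Leibniz identity
    vanish, leaving [[x, b], x] = 0. Inserting [x, b] = r x + s b turns this into r b = 0.\<close>
  have "bracket (bracket x (bracket x x)) x = 0"
    using leibniz [of x "bracket x x" x] by (simp add: bracket_square_left)
  then have "scale r (bracket x x) = 0"
    by (simp add: rs left.add left.scale bracket_square_left)
  with assms(2) rs that show ?thesis
    by simp
qed

lemma cyclic_generatorE:
  assumes "dim (UNIV :: 'v set) = 2" "\<not> is_lie"
  obtains a \<gamma> where "bracket a a \<noteq> 0" "bracket a (bracket a a) = scale \<gamma> (bracket a a)"
    "\<gamma> = 0 \<or> \<gamma> = 1"
proof -
  obtain x where x: "bracket x x \<noteq> 0"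
    using assms(2) unfolding is_lie_def by blast
  then obtain \<beta> where \<beta>: "bracket x (bracket x x) = scale \<beta> (bracket x x)"
    using bracket_square_right_eigen assms(1) by blast
  show ?thesis
  proof (cases "\<beta> = 0")
    case True
    then show ?thesis
      using that x \<beta> by blast
  next
    case False
    \<comment> \<open>Scaling x by c multiplies [x, x] by c^2 and [x, [x, x]] by c^3, hence the
      eigenvalue by c.\<close>
    let ?a = "scale (inverse \<beta>) x"
    have "bracket ?a ?a \<noteq> 0"
      using False x by (simp add: left.scale right.scale)
    moreover have "bracket ?a (bracket ?a ?a) = scale 1 (bracket ?a ?a)"
      using False by (simp add: left.scale right.scale \<beta>)
    ultimately show ?thesis
      using that by blast
  qed
qed

text \<open>Only the a-component of the left factor contributes. The coefficient is the one in
  \<open>cyclic2_bracket\<close>, which makes the coordinate map a homomorphism.\<close>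

lemma bracket_coordinates:
  assumes "bracket a (bracket a a) = scale \<gamma> (bracket a a)"
  shows "bracket (scale r a + scale s (bracket a a)) (scale t a + scale u (bracket a a)) =
    scale (r * (t + \<gamma> * u)) (bracket a a)"
  by (simp add: left.add left.scale right.add right.scale bracket_square_left assms
      scale_left_distrib algebra_simps)

lemma bracket_in_span_square:
  assumes "dim (UNIV :: 'v set) = 2" "bracket a a \<noteq> 0"
    "bracket a (bracket a a) = scale \<gamma> (bracket a a)"
  shows "bracket x y \<in> span {bracket a a}"
  using span_squareE [OF assms(1,2), of x] span_squareE [OF assms(1,2), of y]
    bracket_coordinates [OF assms(3)]
  by (metis insertI1 span_base span_scale)

section \<open>Nilpotency and solvability\<close>

lemma nilpotent_if_eigenvalue_0:
  assumes "dim (UNIV :: 'v set) = 2" "bracket a a \<noteq> 0" "bracket a (bracket a a) = 0"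
  shows nilpotent
proof -
  have eig: "bracket a (bracket a a) = scale 0 (bracket a a)"
    using assms(3) by simp
  have right0: "bracket y z = 0" if z: "z \<in> span {bracket a a}" for y z
  proof -
    obtain t where "z = scale t (bracket a a)"
      using z by (auto simp: span_singleton)
    moreover obtain r s where "y = scale r a + scale s (bracket a a)"
      using span_squareE [OF assms(1,2)] .
    ultimately show ?thesis
      using bracket_coordinates [OF eig, of r s 0 t] by simp
  qed
  have left0: "bracket z y = 0" if "z \<in> span {bracket a a}" for y z
    using that by (auto simp: span_singleton left.scale bracket_square_left)
  \<comment> \<open>The middle conjunct drives the induction: in a product of length at least 3 some
    factor has length at least 2, so it is a multiple of [a, a], which here annihilates from both
    sides.\<close>
  have "n \<ge> 1 \<and> (n \<ge> 2 \<longrightarrow> x \<in> span {bracket a a}) \<and> (n \<ge> 3 \<longrightarrow> x = 0)"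
    if "is_product n x" for n x
    using that
  proof induction
    case (bracket m x n y)
    have "bracket x y = 0" if "m + n \<ge> 3"
    proof -
      have "m \<ge> 2 \<or> n \<ge> 2"
        using that by linarith
      then show ?thesis
        using bracket.IH left0 right0 by blast
    qed
    moreover have "m + n \<ge> 1"
      using bracket.IH by linarith
    ultimately show ?case
      using bracket_in_span_square [OF assms(1,2) eig] by blast
  qed simp
  \<comment> \<open>The witness is c = 2: all products of three elements vanish.\<close>
  then have "x = 0" if "is_product (2 + 1) x" for x
    using that by fastforce
  then show ?thesis
    unfolding nilpotent_def by blast
qed

text \<open>For any \<gamma> all products lie on the line through [a, a], and the bracket is zero on
  that line, so the second derived algebra is 0.\<close>

lemma solvable_if_eigenvector:
  assumes "dim (UNIV :: 'v set) = 2" "bracket a a \<noteq> 0"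
    "bracket a (bracket a a) = scale \<gamma> (bracket a a)"
  shows solvable
proof -
  have "derived_series 1 \<subseteq> span {bracket a a}"
    unfolding One_nat_def derived_series.simps
    using bracket_in_span_square [OF assms] by (intro span_minimal subspace_span) blast
  then have "bracket x y = 0" if "x \<in> derived_series 1" for x y
    using that by (auto simp: span_singleton left.scale bracket_square_left)
  then have "{bracket x y | x y. x \<in> derived_series 1 \<and> y \<in> derived_series 1} \<subseteq> {0}"
    by blast
  then have "derived_series (Suc 1) \<subseteq> {0}"
    unfolding derived_series.simps by (rule span_minimal) (rule subspace_single_0)
  moreover have "0 \<in> derived_series (Suc 1)"
    by (simp add: span_zero)
  ultimately show ?thesis
    unfolding solvable_def by blast
qed

section \<open>Isomorphism with the model\<close>

lemma isomorphic_cyclic2: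
  assumes "dim (UNIV :: 'v set) = 2" "bracket a a \<noteq> 0"
    "bracket a (bracket a a) = scale \<gamma> (bracket a a)"
  shows "leibniz_isomorphic scale bracket (*s) (cyclic2_bracket \<gamma>)"
proof -
  \<comment> \<open>Coordinates are explicit on the model, so the map is built from there. The
    isomorphism required is its inverse.\<close>
  define \<psi> where "\<psi> u = scale (u $ 1) a + scale (u $ 2) (bracket a a)" for u :: "'f ^ 2"
  interpret \<psi>: Vector_Spaces.linear "(*s)" scale \<psi>
    by unfold_locales (simp_all add: \<psi>_def algebra_simps)
  have "u = 0" if "\<psi> u = 0" for u
  proof -
    have "scale (u $ 1) a = scale (- (u $ 2)) (bracket a a)"
      using that by (simp add: \<psi>_def eq_neg_iff_add_eq_0)
    then have "a = scale (inverse (u $ 1) * - (u $ 2)) (bracket a a)" if "u $ 1 \<noteq> 0"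
      using that by (metis left_inverse scale_one scale_scale)
    then have "u $ 1 = 0"
      using square_notin_span [OF assms(2)] by (metis rangeI span_singleton)
    with that assms(2) show "u = 0"
      by (simp add: \<psi>_def vec_eq_iff forall_2)
  qed
  then have inj: "inj \<psi>"
    by (simp add: \<psi>.inj_iff_eq_0)
  have "y \<in> range \<psi>" for y
  proof -
    obtain r s where "y = scale r a + scale s (bracket a a)"
      using span_squareE [OF assms(1,2)] .
    then have "y = \<psi> (vector [r, s])"
      by (simp add: \<psi>_def)
    then show ?thesis
      by blast
  qed
  then have bij: "bij \<psi>"
    using inj by (auto simp: bij_def)
  have hom: "\<psi> (cyclic2_bracket \<gamma> u v) = bracket (\<psi> u) (\<psi> v)" for u v
    by (simp add: \<psi>_def bracket_coordinates [OF assms(3)])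
  have \<psi>_inv: "\<psi> (inv \<psi> x) = x" for x
    using bij by (simp add: bij_is_surj surj_f_inv_f)
  \<comment> \<open>Identities for \<open>inv \<psi>\<close> are checked after applying
    \<open>\<psi>\<close>, where they become \<open>hom\<close> or linearity of
    \<open>\<psi>\<close>.\<close>
  have eqI: "u = v" if "\<psi> u = \<psi> v" for u v
    using inj that by (rule injD)
  have "Vector_Spaces.linear scale (*s) (inv \<psi>)"
    by unfold_locales (rule eqI, simp add: \<psi>_inv \<psi>.add \<psi>.scale)+
  moreover have "inv \<psi> (bracket x y) = cyclic2_bracket \<gamma> (inv \<psi> x) (inv \<psi> y)" for x y
    by (rule eqI) (simp add: \<psi>_inv hom)
  ultimately show ?thesis
    unfolding leibniz_isomorphic_def using bij_imp_bij_inv [OF bij] by blast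
qed

end

theorem theorem6p1:
  fixes scale :: "'f::{alg_closed_field, field_char_0} \<Rightarrow> 'v::ab_group_add \<Rightarrow> 'v"
    and bracket :: "'v \<Rightarrow> 'v \<Rightarrow> 'v"
  assumes "leibniz_algebra scale bracket"
    and "\<not> leibniz_algebra.is_lie bracket"
    and "vector_space.dim scale (UNIV :: 'v set) = 2"
  shows "\<exists>(br :: 'f ^ 2 \<Rightarrow> 'f ^ 2 \<Rightarrow> 'f ^ 2) a.
    leibniz_algebra (*s) br \<and>
    leibniz_isomorphic scale bracket (*s) br \<and>
    leibniz_algebra.generated_by (*s) br a \<and>
    a \<noteq> br a a \<and> leibniz_algebra.is_basis (*s) {a, br a a} \<and>
    (br a (br a a) = 0 \<and> leibniz_algebra.nilpotent bracket \<or>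
     br a (br a a) = br a a \<and> leibniz_algebra.solvable scale bracket)"
proof -
  interpret leibniz_algebra scale bracket
    by (rule assms(1))
  obtain a \<gamma> where a: "bracket a a \<noteq> 0" "bracket a (bracket a a) = scale \<gamma> (bracket a a)"
    and \<gamma>: "\<gamma> = 0 \<or> \<gamma> = 1"
    using cyclic_generatorE [OF assms(3,2)] .
  let ?br = "cyclic2_bracket \<gamma>" and ?e = "axis 1 1 :: 'f ^ 2"
  \<comment> \<open>The relations are read off in the model, whereas nilpotency and solvability are
    established in the given algebra.\<close>
  have "?br ?e (?br ?e ?e) = 0 \<and> nilpotent \<or> ?br ?e (?br ?e ?e) = ?br ?e ?e \<and> solvable"
    using \<gamma> a nilpotent_if_eigenvalue_0 [OF assms(3) a(1)] solvable_if_eigenvector [OF assms(3) a]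
    by auto
  moreover have "?e \<noteq> ?br ?e ?e" "leibniz_algebra.is_basis (*s) {?e, ?br ?e ?e}"
    by (simp_all add: axis_1_neq_axis_2 is_basis_axis2)
  ultimately show ?thesis
    using leibniz_algebra_cyclic2 [of \<gamma>] isomorphic_cyclic2 [OF assms(3) a]
      generated_by_cyclic2 [of \<gamma>]
    by blast
qed

end
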